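(* Let $N\ge 1$, $r>0$, $\mathbf v_1,\dots,\mathbf v_N\in\mathbb R^2$, and let $\mathcal V_n=\{\mathbf x\in\mathbb R^2:\|\mathbf v_n-\mathbf x\|_2\le r\}$ for $n=1,\dots,N$. Let $\mathbf u_0,\mathbf u_{N+1}\in\mathbb R^2$ with $\mathbf u_0,\mathbf u_{N+1}\notin\bigcup_{n}\mathcal V_n$. Suppose that $\mathcal V_n\cap\mathcal V_{n'}=\emptyset$ whenever $n\neq n'$. Let a path $m$ be given, i.e. a permutation $n\mapsto m(n)$ of $\{1,\dots,N\}$, and for each $n$ let $\mathcal U_{m(n)}\subseteq\mathbb R^2$ be the set of optimal collection points for node $m(n)$ (defined in the context). Then for every $n\in\{1,\dots,N\}$: (i) $|\mathcal U_{m(n)}|\ge 1$, and the optimal collection point is not necessarily unique (that is, there exist $N\ge 1$, $r>0$, points $\mathbf v_1,\dots,\mathbf v_N\in\mathbb R^2$ with pairwise disjoint discs $\mathcal V_1,\dots,\mathcal V_N$, points $\mathbf u_0,\mathbf u_{N+1}\in\mathbb R^2\setminus\bigcup_n\mathcal V_n$, and a permutation $m$ of $\{1,\dots,N\}$ for which some $\mathcal U_{m(n)}$ has more than one element); (ii) there exists at least one optimal collection point $\mathbf u^\ast_{m(n)}\in\mathcal U_{m(n)}$ that lies on the circumference of $\mathcal V_{m(n)}$, i.e. $\|\mathbf u^\ast_{m(n)}-\mathbf v_{m(n)}\|_2=r$.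
   Context: A UAV starts at a fixed point $\mathbf u_0$, must visit $N$ ground nodes located at $\mathbf v_1,\dots,\mathbf v_N$, and ends at a fixed point $\mathbf u_{N+1}$. The node $n$ is considered visited when the UAV passes through some point (collection point) $\mathbf u_n\in\mathcal V_n$. For a path $m$, $m(n)$ is the index of the $n$-th visited node. For collection points $\mathbf u_{m(n)}\in\mathcal V_{m(n)}$, the total travel distance is $$D_m=\|\mathbf u_0-\mathbf u_{m(1)}\|_2+\sum_{n=1}^{N-1}\|\mathbf u_{m(n)}-\mathbf u_{m(n+1)}\|_2+\|\mathbf u_{m(N)}-\mathbf u_{N+1}\|_2 .$$ The inner optimization problem for path $m$ is to minimize $D_m$ over all $(\mathbf u_{m(1)},\dots,\mathbf u_{m(N)})$ subject to $\mathbf u_{m(n)}\in\mathcal V_{m(n)}$ for $n=1,\dots,N$. The set $\mathcal U_{m(n)}$ consists of all points $\mathbf u^\ast_{m(n)}$ that occur as the component for node $m(n)$ of some minimizer $(\mathbf u^\ast_{m(1)},\dots,\mathbf u^\ast_{m(N)})$ of this problem. *)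

theory Defs
  imports "HOL-Analysis.Analysis" "HOL-Combinatorics.Permutations"
begin

text \<open>
  Nodes are numbered 1 to N and \<open>u k\<close> is the collection point of node \<open>k\<close>, whatever its place in
  the visiting order \<open>m\<close>. The fixed start and end points (indices 0 and N + 1 in the usual
  notation) are the separate arguments \<open>s\<close> and \<open>e\<close>, so values of \<open>u\<close> outside 1 to N play no role.
\<close>

definition travel_distance ::
    "nat \<Rightarrow> real^2 \<Rightarrow> real^2 \<Rightarrow> (nat \<Rightarrow> nat) \<Rightarrow> (nat \<Rightarrow> real^2) \<Rightarrow> real" where
  "travel_distance N s e m u =
     norm (s - u (m 1)) + (\<Sum>n = 1..N - 1. norm (u (m n) - u (m (n + 1)))) + norm (u (m N) - e)"

definition feasible_points ::
    "nat \<Rightarrow> (nat \<Rightarrow> (real^2) set) \<Rightarrow> (nat \<Rightarrow> nat) \<Rightarrow> (nat \<Rightarrow> real^2) \<Rightarrow> bool" where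
  "feasible_points N V m u \<longleftrightarrow> (\<forall>n\<in>{1..N}. u (m n) \<in> V (m n))"

definition optimal_collection_points ::
    "nat \<Rightarrow> (nat \<Rightarrow> (real^2) set) \<Rightarrow> real^2 \<Rightarrow> real^2 \<Rightarrow> (nat \<Rightarrow> nat) \<Rightarrow> nat \<Rightarrow> (real^2) set" where
  "optimal_collection_points N V s e m k =
     {u k |u. is_arg_min (travel_distance N s e m) (feasible_points N V m) u}"

end

theory Submission imports Defs
begin

text \<open>
  Optimal collection points exist because the travel distance is continuous on a compact product of
  discs. If an optimal point for one disc is moved along the segment towards its predecessor on the
  path, which lies outside the disc, the path does not get longer, and the segment crosses the
  circumference. When the straight segment between start and end crosses a disc, all points of the
  crossing are optimal, which gives non-uniqueness.
\<close>

lemma continuous_on_travel_distance: "continuous_on A (travel_distance N s e m)"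
proof -
  have "continuous_on A (\<lambda>u :: nat \<Rightarrow> real^2. u k)" for k
    by (rule continuous_on_subset[OF continuous_on_product_coordinates]) simp
  then show ?thesis
    unfolding travel_distance_def by (intro continuous_intros)
qed

text \<open>A collection of points is a function on all of \<open>nat\<close>, but the length only
  reads it at the nodes on the path. This permits changing the remaining values freely.\<close>

lemma travel_distance_cong:
  assumes "N \<ge> 1" and "\<And>n. n \<in> {1..N} \<Longrightarrow> u (m n) = w (m n)"
  shows "travel_distance N s e m u = travel_distance N s e m w"
proof -
  have "(\<Sum>n = 1..N - 1. norm (u (m n) - u (m (n + 1)))) =
        (\<Sum>n = 1..N - 1. norm (w (m n) - w (m (n + 1))))"
    using assms by (intro sum.cong) auto
  then show ?thesis
    using assms by (simp add: travel_distance_def)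
qed

text \<open>The feasible functions do not form a compact set, because values off the path are
  unconstrained. Pinning those values to 0 gives a compact product without changing any achievable
  length.\<close>

lemma ex_arg_min_travel_distance:
  assumes "N \<ge> 1" and "\<And>n. n \<in> {1..N} \<Longrightarrow> compact (V (m n))"
    and "\<And>n. n \<in> {1..N} \<Longrightarrow> V (m n) \<noteq> {}"
  shows "\<exists>u. is_arg_min (travel_distance N s e m) (feasible_points N V m) u"
proof -
  define W where "W k = (if k \<in> m ` {1..N} then V k else {0})" for k
  have W: "compact (W k)" "W k \<noteq> {}" for k
    using assms by (auto simp: W_def)
  \<comment> \<open>Tychonoff's theorem, transferred from abstract topologies to the topology of the
    function type.\<close>
  then have "compact (PiE UNIV W)" and "PiE UNIV W \<noteq> {}"
    using compactin_PiE[of "\<lambda>_. euclidean" UNIV W]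
    by (auto simp: euclidean_product_topology PiE_eq_empty_iff)
  then obtain u where u: "u \<in> PiE UNIV W"
    and min: "\<And>w. w \<in> PiE UNIV W \<Longrightarrow> travel_distance N s e m u \<le> travel_distance N s e m w"
    using continuous_attains_inf continuous_on_travel_distance by metis
  have feas: "feasible_points N V m u"
    unfolding feasible_points_def
  proof
    fix n assume "n \<in> {1..N}"
    then show "u (m n) \<in> V (m n)"
      using PiE_mem[OF u, of "m n"] by (auto simp: W_def)
  qed
  have "travel_distance N s e m u \<le> travel_distance N s e m w" if w: "feasible_points N V m w" for w
  proof -
    \<comment> \<open>Resetting \<open>w\<close> to 0 off the path moves it into the compact product
      and keeps its length, so the minimum there bounds every feasible choice.\<close>
    define w' where "w' k = (if k \<in> m ` {1..N} then w k else 0)" for k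
    have "w' \<in> PiE UNIV W"
      using w by (auto simp: w'_def W_def feasible_points_def)
    moreover have "travel_distance N s e m w = travel_distance N s e m w'"
      by (intro travel_distance_cong \<open>N \<ge> 1\<close>) (auto simp: w'_def)
    ultimately show ?thesis
      using min by simp
  qed
  with feas show ?thesis
    by (auto simp: is_arg_min_linorder)
qed

text \<open>A segment is connected, so joining a point inside the ball to one outside it must cross
  the frontier. If \<open>x\<close> is already on the sphere, \<open>x\<close> itself
  serves.\<close>

lemma closed_segment_meets_sphere:
  fixes x p v :: "'a::euclidean_space"
  assumes "x \<in> cball v r" and "p \<notin> cball v r"
  obtains y where "y \<in> closed_segment p x" and "y \<in> sphere v r"
proof (cases "x \<in> sphere v r")
  case False
  have "r \<noteq> 0" using assms False by auto
  then have "frontier (cball v r) = sphere v r" by simp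
  moreover have "closed_segment p x \<inter> frontier (cball v r) \<noteq> {}"
    using assms by (intro connected_Int_frontier) auto
  ultimately obtain y where "y \<in> closed_segment p x" and "y \<in> sphere v r"
    by blast
  then show thesis by (rule that)
qed (use that in auto)

text \<open>Going from \<open>p\<close> to \<open>x\<close> through \<open>y\<close> costs nothing
  extra, and the triangle inequality lets \<open>y\<close> go straight to \<open>q\<close> instead
  of via \<open>x\<close>.\<close>

lemma norm_segment_decrease:
  fixes p q x y :: "'a::euclidean_space"
  assumes "y \<in> closed_segment p x"
  shows "norm (p - y) + norm (y - q) \<le> norm (p - x) + norm (x - q)"
proof -
  have "dist p x = dist p y + dist y x"
    using assms by (simp flip: between between_mem_segment)
  with dist_triangle[of y q x] show ?thesis
    by (simp add: dist_norm)
qed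

text \<open>Writing the first and last legs as terms 0 and \<open>N\<close> of one sum makes the
  n-th stop an endpoint of exactly the legs \<open>n - 1\<close> and \<open>n\<close>, also at both
  ends of the path.\<close>

lemma travel_distance_eq_sum:
  assumes "N \<ge> 1"
  shows "travel_distance N s e m u =
    (\<Sum>k\<le>N. norm ((if k = 0 then s else u (m k)) - (if k = N then e else u (m (k + 1)))))"
proof -
  obtain M where M: "N = Suc M"
    using assms by (cases N) auto
  show ?thesis
    unfolding travel_distance_def M
    by (simp add: sum.atMost_shift[of _ M] sum.atLeast1_atMost_eq)
qed

text \<open>By injectivity of \<open>m\<close>, the update moves only the n-th stop. All legs but
  the two adjacent ones cancel, and those two are compared by
  \<open>norm_segment_decrease\<close>.\<close>

lemma travel_distance_update_le:
  assumes inj: "inj_on m {1..N}" and n: "n \<in> {1..N}"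
    and y: "y \<in> closed_segment (if n = 1 then s else u (m (n - 1))) (u (m n))"
  shows "travel_distance N s e m (u(m n := y)) \<le> travel_distance N s e m u"
proof -
  define w where "w = u(m n := y)"
  have N: "N \<ge> 1" using n by auto
  define F where "F u k = norm ((if k = 0 then s else u (m k)) - (if k = N then e else u (m (k + 1))))"
    for u :: "nat \<Rightarrow> real^2" and k
  have w_other: "w (m k) = u (m k)" if "k \<in> {1..N}" "k \<noteq> n" for k
    using inj_onD[OF inj, of k n] that n by (auto simp: w_def)
  have w_n: "w (m n) = y" by (simp add: w_def)
  \<comment> \<open>Since \<open>n \<ge> 1\<close>, the indices \<open>n - 1\<close> and
    \<open>n\<close> are distinct despite truncated subtraction.\<close>
  have split: "(\<Sum>k\<le>N. F u k) = F u (n - 1) + F u n + (\<Sum>k\<in>{..N} - {n - 1, n}. F u k)" for u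
    using n by (subst sum.subset_diff[of "{n - 1, n}"]) auto
  have "F w k = F u k" if "k \<in> {..N} - {n - 1, n}" for k
    using that n w_other[of k] w_other[of "k + 1"] by (auto simp: F_def)
  then have rest: "(\<Sum>k\<in>{..N} - {n - 1, n}. F w k) = (\<Sum>k\<in>{..N} - {n - 1, n}. F u k)"
    by (rule sum.cong[OF refl])
  define p where "p = (if n = 1 then s else u (m (n - 1)))"
  define q where "q = (if n = N then e else u (m (n + 1)))"
  have "F u (n - 1) = norm (p - u (m n))" "F u n = norm (u (m n) - q)"
    using n by (auto simp: F_def p_def q_def)
  moreover have "F w (n - 1) = norm (p - y)" "F w n = norm (y - q)"
    using n w_n w_other[of "n - 1"] w_other[of "n + 1"] by (cases "n = 1"; force simp: F_def p_def q_def)+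
  moreover have "norm (p - y) + norm (y - q) \<le> norm (p - u (m n)) + norm (u (m n) - q)"
    using y by (intro norm_segment_decrease) (simp add: p_def)
  ultimately have "(\<Sum>k\<le>N. F w k) \<le> (\<Sum>k\<le>N. F u k)"
    unfolding split rest by linarith
  then show ?thesis
    unfolding travel_distance_eq_sum[OF N] F_def w_def .
qed

text \<open>The moved point need not shorten the path: as \<open>u\<close> is already a minimizer, a
  feasible update that is no longer is a minimizer too.\<close>

lemma ex_optimal_collection_point_sphere:
  assumes inj: "inj_on m {1..N}" and n: "n \<in> {1..N}" and V: "V (m n) = cball c r"
    and s: "s \<notin> V (m n)" and disj: "n \<noteq> 1 \<Longrightarrow> V (m (n - 1)) \<inter> V (m n) = {}"
    and opt: "is_arg_min (travel_distance N s e m) (feasible_points N V m) u"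
  shows "\<exists>x\<in>optimal_collection_points N V s e m (m n). x \<in> sphere c r"
proof -
  define p where "p = (if n = 1 then s else u (m (n - 1)))"
  have feas: "u (m k) \<in> V (m k)" if "k \<in> {1..N}" for k
    using opt that by (auto simp: is_arg_min_def feasible_points_def)
  have "p \<notin> cball c r"
  proof (cases "n = 1")
    case False
    then have "u (m (n - 1)) \<in> V (m (n - 1))"
      using n by (intro feas) auto
    with False disj V show ?thesis
      by (auto simp: p_def)
  qed (use s V in \<open>auto simp: p_def\<close>)
  moreover have "u (m n) \<in> cball c r"
    using feas[OF n] V by simp
  ultimately obtain y where y: "y \<in> closed_segment p (u (m n))" "y \<in> sphere c r"
    using closed_segment_meets_sphere by metis
  have "feasible_points N V m (u(m n := y))"
    using feas y V by (auto simp: feasible_points_def)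
  moreover have "travel_distance N s e m (u(m n := y)) \<le> travel_distance N s e m u"
    using y by (intro travel_distance_update_le inj n) (simp add: p_def)
  ultimately have "is_arg_min (travel_distance N s e m) (feasible_points N V m) (u(m n := y))"
    using opt by (force simp: is_arg_min_linorder)
  then have "y \<in> optimal_collection_points N V s e m (m n)"
    unfolding optimal_collection_points_def by (auto intro!: exI[of _ "u(m n := y)"])
  with y show ?thesis by blast
qed

text \<open>With one node, every path has length at least \<open>dist s e\<close>, and equality
  holds at the points of the segment from \<open>s\<close> to \<open>e\<close>.\<close>

lemma optimal_collection_points_single:
  assumes "x \<in> V 1" and "x \<in> closed_segment s e"
  shows "x \<in> optimal_collection_points 1 V s e id 1"
proof -
  have "dist s e = dist s x + dist x e"
    using assms by (simp flip: between between_mem_segment)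
  then have "norm (s - x) + norm (x - e) \<le> norm (s - y) + norm (y - e)" for y
    using dist_triangle[of s e y] by (simp add: dist_norm)
  then have "is_arg_min (travel_distance 1 s e id) (feasible_points 1 V id) (\<lambda>_. x)"
    using assms by (auto simp: is_arg_min_linorder travel_distance_def feasible_points_def)
  then show ?thesis
    unfolding optimal_collection_points_def by force
qed

text \<open>The endpoints lie outside the unit disc, on opposite sides of its centre, so the segment
  between them contains a whole diameter. Its centre and one of its ends are two optimal
  points.\<close>

lemma optimal_collection_points_not_unique:
  fixes a :: "real^2"
  assumes "norm a = 1"
  defines "U \<equiv> optimal_collection_points 1 (\<lambda>_. cball 0 1) (- 2 *\<^sub>R a) (2 *\<^sub>R a) id 1"
  shows "0 \<in> U" and "a \<in> U"
proof -
  have "0 \<in> closed_segment (- 2 *\<^sub>R a) (2 *\<^sub>R a)"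
    unfolding in_segment by (intro exI[of _ "1/2"]) auto
  moreover have "a \<in> closed_segment (- 2 *\<^sub>R a) (2 *\<^sub>R a)"
    unfolding in_segment by (intro exI[of _ "3/4"]) (auto simp: vec_eq_iff)
  ultimately show "0 \<in> U" and "a \<in> U"
    unfolding U_def using assms(1) by (intro optimal_collection_points_single; simp)+
qed

theorem theorem1:
  fixes N :: nat and r :: real and v :: "nat \<Rightarrow> real^2" and V :: "nat \<Rightarrow> (real^2) set"
    and u\<^sub>0 u\<^sub>e :: "real^2" and m :: "nat \<Rightarrow> nat"
  assumes "N \<ge> 1" and "r > 0"
    and "\<And>n. V n = cball (v n) r"
    and "u\<^sub>0 \<notin> (\<Union>n\<in>{1..N}. V n)" and "u\<^sub>e \<notin> (\<Union>n\<in>{1..N}. V n)"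
    and "disjoint_family_on V {1..N}"
    and "m permutes {1..N}"
  shows "(\<forall>n\<in>{1..N}. optimal_collection_points N V u\<^sub>0 u\<^sub>e m (m n) \<noteq> {}) \<and>
    (\<exists>(N' :: nat) (r' :: real) (v' :: nat \<Rightarrow> real^2) (V' :: nat \<Rightarrow> (real^2) set)
        (s :: real^2) (e :: real^2) (m' :: nat \<Rightarrow> nat).
       N' \<ge> 1 \<and> r' > 0 \<and> (\<forall>n. V' n = cball (v' n) r') \<and>
       s \<notin> (\<Union>n\<in>{1..N'}. V' n) \<and> e \<notin> (\<Union>n\<in>{1..N'}. V' n) \<and>
       disjoint_family_on V' {1..N'} \<and> m' permutes {1..N'} \<and>
       (\<exists>n\<in>{1..N'}. \<exists>x\<in>optimal_collection_points N' V' s e m' (m' n).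
          \<exists>y\<in>optimal_collection_points N' V' s e m' (m' n). x \<noteq> y)) \<and>
    (\<forall>n\<in>{1..N}. \<exists>x\<in>optimal_collection_points N V u\<^sub>0 u\<^sub>e m (m n). norm (x - v (m n)) = r)"
proof (intro conjI)
  \<comment> \<open>The positive radius makes each disc nonempty, as existence of a minimizer
    requires.\<close>
  obtain u where u: "is_arg_min (travel_distance N u\<^sub>0 u\<^sub>e m) (feasible_points N V m) u"
    using ex_arg_min_travel_distance[of N V m u\<^sub>0 u\<^sub>e] assms(1-3) by auto
  then show "\<forall>n\<in>{1..N}. optimal_collection_points N V u\<^sub>0 u\<^sub>e m (m n) \<noteq> {}"
    by (auto simp: optimal_collection_points_def)
  show "\<forall>n\<in>{1..N}. \<exists>x\<in>optimal_collection_points N V u\<^sub>0 u\<^sub>e m (m n). norm (x - v (m n)) = r"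
  proof
    fix n assume n: "n \<in> {1..N}"
    have inj: "inj_on m {1..N}"
      using assms(7) by (rule permutes_inj_on)
    have m: "m k \<in> {1..N}" if "k \<in> {1..N}" for k
      using permutes_in_image[OF assms(7)] that by simp
    have "V (m (n - 1)) \<inter> V (m n) = {}" if "n \<noteq> 1"
    proof -
      have k: "n - 1 \<in> {1..N}" using n that by auto
      then have "m (n - 1) \<noteq> m n"
        using inj_onD[OF inj, of "n - 1" n] n by auto
      with assms(6) m[OF k] m[OF n] show ?thesis
        by (simp add: disjoint_family_on_def)
    qed
    moreover have "u\<^sub>0 \<notin> V (m n)"
      using assms(4) m[OF n] by blast
    ultimately obtain x where "x \<in> optimal_collection_points N V u\<^sub>0 u\<^sub>e m (m n)"
      and "x \<in> sphere (v (m n)) r"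
      using ex_optimal_collection_point_sphere[OF inj n assms(3) _ _ u] by auto
    then show "\<exists>x\<in>optimal_collection_points N V u\<^sub>0 u\<^sub>e m (m n). norm (x - v (m n)) = r"
      by (auto simp: dist_norm norm_minus_commute)
  qed
  \<comment> \<open>Any unit vector gives the direction of the line in the example with one node and
    the unit disc at the origin.\<close>
  obtain a :: "real^2" where a: "norm a = 1"
    using vector_choose_size[of 1] by auto
  then have "a \<noteq> 0" by auto
  with optimal_collection_points_not_unique[OF a]
  have "\<exists>n\<in>{1..1::nat}.
      \<exists>x\<in>optimal_collection_points 1 (\<lambda>_. cball 0 1) (- 2 *\<^sub>R a) (2 *\<^sub>R a) id (id n).
      \<exists>y\<in>optimal_collection_points 1 (\<lambda>_. cball 0 1) (- 2 *\<^sub>R a) (2 *\<^sub>R a) id (id n). x \<noteq> y"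
    by auto
  with a show "\<exists>(N' :: nat) (r' :: real) (v' :: nat \<Rightarrow> real^2) (V' :: nat \<Rightarrow> (real^2) set)
        (s :: real^2) (e :: real^2) (m' :: nat \<Rightarrow> nat).
       N' \<ge> 1 \<and> r' > 0 \<and> (\<forall>n. V' n = cball (v' n) r') \<and>
       s \<notin> (\<Union>n\<in>{1..N'}. V' n) \<and> e \<notin> (\<Union>n\<in>{1..N'}. V' n) \<and>
       disjoint_family_on V' {1..N'} \<and> m' permutes {1..N'} \<and>
       (\<exists>n\<in>{1..N'}. \<exists>x\<in>optimal_collection_points N' V' s e m' (m' n).
          \<exists>y\<in>optimal_collection_points N' V' s e m' (m' n). x \<noteq> y)"
    by (intro exI[of _ "1::nat"] exI[of _ "1::real"] exI[of _ "\<lambda>_. 0"] exI[of _ "\<lambda>_. cball 0 1"]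
        exI[of _ "- 2 *\<^sub>R a"] exI[of _ "2 *\<^sub>R a"] exI[of _ id] conjI)
      (auto simp: disjoint_family_on_def permutes_id)
qed

end
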